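(* Let $p$ be a prime. (i) If $p\equiv 7\pmod 8$, then $$\sum_{k=0}^{p-1}\binom{p-1}{k}\binom{2k}{k}^2\frac{W_k}{4^k}\equiv 0\pmod{p^2},$$ where $W_0=0$, $W_1=1$, and $W_n=8W_{n-1}+2W_{n-2}$ for $n\ge 2$. (ii) If $p\equiv 1\pmod 6$, then $$\sum_{k=0}^{p-1}\binom{p-1}{k}\binom{2k}{k}^2\frac{(-1)^kM_k}{16^k}\equiv 0\pmod{p^2},$$ where $M_0=0$, $M_1=1$, and $M_n=3M_{n-1}-3M_{n-2}$ for $n\ge 2$. (iii) If $p\equiv 7\pmod{12}$, then $$\sum_{\substack{0\le k\le p-1\\ k\equiv 0\pmod 3}}\binom{p-1}{k}\binom{2k}{k}^2\frac{1}{16^k}\equiv\frac13\sum_{k=0}^{p-1}\binom{p-1}{k}\binom{2k}{k}^2\frac{1}{16^k}\pmod{p^2}.$$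
   Context: Congruences are between rational numbers whose denominators are prime to $p$: for such $r,s$, $r\equiv s\pmod{p^2}$ means that the numerator of $r-s$ in lowest terms is divisible by $p^2$. *)

theory Defs
  imports Complex_Main "HOL-Number_Theory.Number_Theory"
begin

(* quotient_of returns the numerator and the positive denominator in lowest terms.
   Requiring the denominators of r and s to be prime to p is part of the relation, so the
   congruence also asserts that both sides are p-integral. *)
definition rat_cong_sq :: "nat \<Rightarrow> rat \<Rightarrow> rat \<Rightarrow> bool" where
  "rat_cong_sq p r s \<longleftrightarrow>
     coprime (snd (quotient_of r)) (int p) \<and>
     coprime (snd (quotient_of s)) (int p) \<and>
     int p ^ 2 dvd fst (quotient_of (r - s))"

fun W :: "nat \<Rightarrow> int" where
  "W 0 = 0"
| "W (Suc 0) = 1"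
| "W (Suc (Suc n)) = 8 * W (Suc n) + 2 * W n"

fun M :: "nat \<Rightarrow> int" where
  "M 0 = 0"
| "M (Suc 0) = 1"
| "M (Suc (Suc n)) = 3 * M (Suc n) - 3 * M n"

end

theory Submission
  imports Defs "HOL-Computational_Algebra.Polynomial"
begin

text \<open>
  Write $p = 2n + 1$, $T_k = \binom{p-1}{k}\binom{2k}{k}^2 / 16^k$ and
  $d_k = (n+1)_k / (2n+2)_k$. Then $T_k \equiv \binom{n}{k} d_k$ modulo $p^2$. The numbers $d_k$ are
  the moments of the Beta distribution with parameters $(n+1, n+1)$, and the symmetry of this
  distribution under $X \mapsto 1 - X$ gives the exact functional equation
  $F(x) = (1-x)^n F(x/(x-1))$ for $F(x) = \sum_k \binom{n}{k} d_k (-x)^k$. In (ii) and (iii) the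
  relevant arguments, $1 - \omega$ and $-\omega$ with $\omega$ a primitive cube root of unity, are
  swapped with their conjugates and $(1-x)^n = \pm 1$, so the sums over $\binom{n}{k} d_k$ are
  exactly zero.

  In (i) the arguments are $-16 \mp 12\sqrt{2}$, with $\sqrt{2}$ read in the integers modulo $p^2$.
  Here $1 - x = (3 + 2\sqrt{2})^2$ gives only $(1-x)^n \equiv 1$ modulo $p$, and the missing factor
  $p$ comes from $F(x) \equiv \sum_k \binom{n}{k}^2 x^k \equiv 0$ modulo $p$: Landen's
  transformation carries $1 - x$ to $1/2$, where the sum vanishes because it changes by the sign
  $(-1)^n = -1$ under $x \mapsto 1 - x$.
\<close>

section \<open>Binomial sums over moment sequences\<close>

text \<open>Pascal's rule, in the form used for inductions on the upper index.\<close>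

lemma sum_choose_Suc:
  fixes g :: "nat \<Rightarrow> 'a::comm_semiring_1"
  shows "(\<Sum>k\<le>Suc n. of_nat (Suc n choose k) * g k)
       = (\<Sum>k\<le>n. of_nat (n choose k) * (g k + g (Suc k)))"
proof -
  have "(\<Sum>k\<le>Suc n. of_nat (Suc n choose k) * g k)
      = g 0 + (\<Sum>k\<le>n. of_nat (n choose Suc k) * g (Suc k))
        + (\<Sum>k\<le>n. of_nat (n choose k) * g (Suc k))"
    unfolding sum.atMost_Suc_shift by (simp add: sum.distrib algebra_simps)
  also have "g 0 + (\<Sum>k\<le>n. of_nat (n choose Suc k) * g (Suc k))
      = (\<Sum>k\<le>Suc n. of_nat (n choose k) * g k)"
    unfolding sum.atMost_Suc_shift by simp
  also have "\<dots> = (\<Sum>k\<le>n. of_nat (n choose k) * g k)"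
    by (simp add: binomial_eq_0)
  finally show ?thesis by (simp add: sum.distrib distrib_left)
qed

text \<open>Read \<open>f i j\<close> as the expectation of X^i (1 - X)^j; the hypothesis is then 1
  = X + (1 - X). Both sides are the expectation of X^i (1 - X)^j (1 - x X)^n, expanded as it stands
  and after writing 1 - x X = (1 - x) + x (1 - X).\<close>

lemma binomial_transform_moments:
  fixes x :: "'a::comm_ring_1" and f :: "nat \<Rightarrow> nat \<Rightarrow> 'a"
  assumes f: "\<And>i j. f i j = f (Suc i) j + f i (Suc j)"
  shows "(\<Sum>k\<le>n. of_nat (n choose k) * ((- x) ^ k * f (i + k) j))
       = (\<Sum>k\<le>n. of_nat (n choose k) * (x ^ k * (1 - x) ^ (n - k) * f i (j + k)))"
proof (induction n arbitrary: i)
  case 0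
  show ?case by simp
next
  case (Suc n)
  let ?S = "\<lambda>i. \<Sum>k\<le>n. of_nat (n choose k) * ((- x) ^ k * f (i + k) j)"
  let ?T = "\<lambda>i. \<Sum>k\<le>n. of_nat (n choose k) * (x ^ k * (1 - x) ^ (n - k) * f i (j + k))"
  have "(\<Sum>k\<le>Suc n. of_nat (Suc n choose k) * ((- x) ^ k * f (i + k) j)) = ?S i - x * ?S (Suc i)"
    unfolding sum_choose_Suc by (simp add: sum.distrib sum_subtractf sum_distrib_left algebra_simps)
  also have "\<dots> = ?T i - x * ?T (Suc i)"
    by (simp only: Suc.IH)
  also have "\<dots> = (\<Sum>k\<le>n. of_nat (n choose k) *
      (x ^ k * (1 - x) ^ (n - k) * (f i (j + k) - x * f (Suc i) (j + k))))"
    by (simp add: sum_subtractf sum_distrib_left algebra_simps)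
  also have "\<dots> = (\<Sum>k\<le>n. of_nat (n choose k) *
      (x ^ k * (1 - x) ^ (Suc n - k) * f i (j + k) +
       x ^ Suc k * (1 - x) ^ (Suc n - Suc k) * f i (j + Suc k)))"
  proof (rule sum.cong[OF refl])
    fix k assume "k \<in> {..n}"
    then have k: "Suc n - k = Suc (n - k)" by auto
    \<comment> \<open>Trading X for 1 - X produces the two neighbouring terms that Pascal's rule
      recombines.\<close>
    have eq: "f (Suc i) (j + k) = f i (j + k) - f i (j + Suc k)"
      using f[of i "j + k"] by simp
    show "of_nat (n choose k) * (x ^ k * (1 - x) ^ (n - k) * (f i (j + k) - x * f (Suc i) (j + k)))
      = of_nat (n choose k) * (x ^ k * (1 - x) ^ (Suc n - k) * f i (j + k) +
       x ^ Suc k * (1 - x) ^ (Suc n - Suc k) * f i (j + Suc k))"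
      by (simp only: k eq) (simp add: algebra_simps)
  qed
  also have "\<dots> = (\<Sum>k\<le>Suc n. of_nat (Suc n choose k) *
      (x ^ k * (1 - x) ^ (Suc n - k) * f i (j + k)))"
    unfolding sum_choose_Suc by simp
  finally show ?case .
qed

text \<open>Consecutive-term ratios like this one drive the inductions on \<open>k\<close> below.
  The subtraction is rational, so the ratio vanishes at \<open>k = m\<close> and the identity
  persists beyond.\<close>

lemma of_nat_binomial_Suc: "rat_of_nat (m choose Suc k) = of_nat (m choose k) * ((of_nat m - of_nat k) / of_nat (Suc k))"
proof -
  have "Suc k * (m choose Suc k) = (m - k) * (m choose k)"
    by (simp only: binomial_absorption binomial_absorb_comp)
  then have "rat_of_nat (Suc k * (m choose Suc k)) = of_nat ((m - k) * (m choose k))"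
    by (simp only:)
  then have "of_nat (Suc k) * rat_of_nat (m choose Suc k) = (of_nat m - of_nat k) * of_nat (m choose k)"
    by (cases "k \<le> m") (simp_all add: of_nat_diff binomial_eq_0 del: of_nat_Suc mult_Suc)
  then show ?thesis by (simp add: field_simps del: of_nat_Suc)
qed

lemma of_nat_central_binomial_Suc:
  "rat_of_nat ((2 * Suc k) choose Suc k) = of_nat ((2 * k) choose k) * (2 * of_nat (2 * k + 1) / of_nat (Suc k))"
proof -
  have "Suc k * ((2 * Suc k) choose Suc k) = Suc k * (2 * (Suc (2 * k) choose k))"
    using Suc_times_binomial[of k "Suc (2 * k)"] by (simp del: binomial_Suc_Suc)
  also have "Suc (2 * k) choose k = Suc (2 * k) choose Suc k"
    using binomial_symmetric[of k "Suc (2 * k)"] by (simp add: Suc_diff_le del: binomial_Suc_Suc)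
  also have "Suc k * (2 * (Suc (2 * k) choose Suc k)) = 2 * (2 * k + 1) * ((2 * k) choose k)"
    using Suc_times_binomial[of k "2 * k"] by (simp del: binomial_Suc_Suc)
  finally have "Suc k * ((2 * Suc k) choose Suc k) = 2 * (2 * k + 1) * ((2 * k) choose k)" .
  then have "rat_of_nat (Suc k * ((2 * Suc k) choose Suc k)) = of_nat (2 * (2 * k + 1) * ((2 * k) choose k))"
    by (simp only:)
  then have "of_nat (Suc k) * rat_of_nat ((2 * Suc k) choose Suc k)
      = 2 * of_nat (2 * k + 1) * of_nat ((2 * k) choose k)"
    by (simp only: of_nat_mult of_nat_numeral)
  then show ?thesis
    by (simp add: eq_divide_eq mult_ac del: of_nat_Suc mult_Suc_right binomial_Suc_Suc)
qed

section \<open>Moments of the symmetric Beta distribution\<close>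

text \<open>The \<open>k\<close>-th moment of the Beta distribution with both parameters equal to
  \<open>m\<close>.\<close>

definition beta_moment :: "nat \<Rightarrow> nat \<Rightarrow> rat" where
  "beta_moment m k = pochhammer (of_nat m) k / pochhammer (of_nat (2 * m)) k"

lemma beta_moment_0 [simp]: "beta_moment m 0 = 1"
  by (simp add: beta_moment_def)

lemma beta_moment_Suc:
  "beta_moment m (Suc k) = beta_moment m k * (of_nat (m + k) / of_nat (2 * m + k))"
  by (simp add: beta_moment_def pochhammer_Suc)

text \<open>The symmetry under X \<mapsto> 1 - X enters as \<open>e k 0 = e 0 k\<close> for the
  mixed moments \<open>e\<close>. A general field of characteristic 0 allows both rational and
  complex arguments.\<close>

lemma beta_moment_transform:
  fixes x :: "'a::field_char_0"
  assumes "m > 0"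
  shows "(\<Sum>k\<le>n. of_nat (n choose k) * of_rat (beta_moment m k) * (- x) ^ k)
       = (\<Sum>k\<le>n. of_nat (n choose k) * of_rat (beta_moment m k) * (x ^ k * (1 - x) ^ (n - k)))"
proof -
  define e :: "nat \<Rightarrow> nat \<Rightarrow> rat" where
    "e i j = pochhammer (of_nat m) i * pochhammer (of_nat m) j / pochhammer (of_nat (2 * m)) (i + j)" for i j
  have rec: "e i j = e (Suc i) j + e i (Suc j)" for i j
  proof -
    \<comment> \<open>The factors m + i and m + j of the two right-hand terms add up to
      \<open>?q\<close>.\<close>
    let ?q = "of_nat (2 * m) + of_nat (i + j) :: rat"
    have q: "?q > 0" using assms by (simp add: add_pos_nonneg)
    have "e (Suc i) j + e i (Suc j) = (pochhammer (of_nat m) i * pochhammer (of_nat m) j * ?q)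
        / (pochhammer (of_nat (2 * m)) (i + j) * ?q)"
      by (simp add: e_def pochhammer_Suc add_divide_distrib [symmetric] algebra_simps)
    also have "\<dots> = e i j"
      unfolding e_def using q by (intro nonzero_mult_divide_mult_cancel_right) auto
    finally show ?thesis ..
  qed
  have e: "e k 0 = beta_moment m k" "e 0 k = beta_moment m k" for k
    by (simp_all add: e_def beta_moment_def)
  have "of_rat (e i j) = of_rat (e (Suc i) j) + (of_rat (e i (Suc j)) :: 'a)" for i j
    unfolding of_rat_add [symmetric] rec [symmetric] ..
  from binomial_transform_moments[of "\<lambda>i j. of_rat (e i j)", OF this, of n x 0 0] show ?thesis
    by (simp add: e mult_ac)
qed

text \<open>The condition on \<open>x'\<close> says x' = x / (x - 1) without division. It gives x =
  (1 - x)(-x'), so each x^k (1 - x)^(n-k) becomes (1 - x)^n (-x')^k.\<close>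

lemma beta_moment_transform_conj:
  fixes x x' :: "'a::field_char_0"
  assumes "m > 0" and "x + x' = x * x'"
  shows "(\<Sum>k\<le>n. of_nat (n choose k) * of_rat (beta_moment m k) * (- x) ^ k)
       = (1 - x) ^ n * (\<Sum>k\<le>n. of_nat (n choose k) * of_rat (beta_moment m k) * (- x') ^ k)"
proof -
  have x: "x = (1 - x) * (- x')"
    using assms(2) by (simp add: algebra_simps eq_neg_iff_add_eq_0)
  have "x ^ k * (1 - x) ^ (n - k) = (1 - x) ^ n * (- x') ^ k" if "k \<le> n" for k
  proof -
    have "x ^ k * (1 - x) ^ (n - k) = (1 - x) ^ k * (- x') ^ k * (1 - x) ^ (n - k)"
      by (subst x) (simp only: power_mult_distrib)
    also have "\<dots> = (1 - x) ^ (k + (n - k)) * (- x') ^ k"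
      by (simp only: power_add mult_ac)
    finally show ?thesis using that by simp
  qed
  then show ?thesis
    by (subst beta_moment_transform[OF assms(1)], unfold sum_distrib_left, intro sum.cong)
       (auto simp: mult_ac)
qed

section \<open>Landen's transformation and sums of squared binomial coefficients\<close>

text \<open>Landen's transformation in polynomial form: both sides are the coefficient of $t^n$ in
  $((1 - yt)(t - y))^n = ((1 + y)^2 t - y (1 + t)^2)^n$.\<close>

lemma landen_binomial_sum:
  fixes y :: int
  shows "(\<Sum>j\<le>n. of_nat (n choose j) * of_nat ((2 * j) choose j) * (- y) ^ j * ((1 + y)\<^sup>2) ^ (n - j))
       = (\<Sum>j\<le>n. (of_nat (n choose j))\<^sup>2 * (y\<^sup>2) ^ j)"
proof -
  have eq: "[:1, - y:] * [:- y, 1:] = smult (- y) ([:1, 1:]\<^sup>2) + monom ((1 + y)\<^sup>2) 1"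
    by (simp add: monom_altdef power2_eq_square algebra_simps)
  have "coeff ((smult (- y) ([:1, 1:]\<^sup>2) + monom ((1 + y)\<^sup>2) 1) ^ n) n
      = (\<Sum>j\<le>n. coeff (of_nat (n choose j) * (smult (- y) ([:1, 1:]\<^sup>2)) ^ j * monom ((1 + y)\<^sup>2) 1 ^ (n - j)) n)"
    by (simp only: binomial_ring[of "smult (- y) ([:1, 1:]\<^sup>2)"] coeff_sum)
  also have "\<dots> = (\<Sum>j\<le>n. of_nat (n choose j) * of_nat ((2 * j) choose j) * (- y) ^ j * ((1 + y)\<^sup>2) ^ (n - j))"
  proof (rule sum.cong[OF refl])
    fix j assume "j \<in> {..n}"
    then have j: "j \<le> n" by simp
    have "of_nat (n choose j) * (smult (- y) ([:1, 1:]\<^sup>2)) ^ j * monom ((1 + y)\<^sup>2) 1 ^ (n - j)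
        = monom (((1 + y)\<^sup>2) ^ (n - j)) (n - j) * (smult (of_nat (n choose j) * (- y) ^ j) ([:1, 1:] ^ (2 * j)))"
      by (simp add: smult_power monom_power power_mult [symmetric] of_nat_poly mult_ac
            del: smult_minus_left)
    \<comment> \<open>The monomial of degree n - j leaves the coefficient of t^j in (1 + t)^(2j), a
      central binomial coefficient.\<close>
    also have "coeff \<dots> n = of_nat (n choose j) * of_nat ((2 * j) choose j) * (- y) ^ j * ((1 + y)\<^sup>2) ^ (n - j)"
      using j by (simp add: coeff_monom_mult coeff_linear_poly_power)
    finally show "coeff (of_nat (n choose j) * (smult (- y) ([:1, 1:]\<^sup>2)) ^ j * monom ((1 + y)\<^sup>2) 1 ^ (n - j)) n
      = of_nat (n choose j) * of_nat ((2 * j) choose j) * (- y) ^ j * ((1 + y)\<^sup>2) ^ (n - j)" .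
  qed
  finally have L: "coeff (([:1, - y:] * [:- y, 1:]) ^ n) n = \<dots>" by (simp only: eq)
  have "coeff (([:1, - y:] * [:- y, 1:]) ^ n) n
      = (\<Sum>j\<le>n. coeff ([:1, - y:] ^ n) j * coeff ([:- y, 1:] ^ n) (n - j))"
    by (simp only: power_mult_distrib coeff_mult)
  also have "\<dots> = (\<Sum>j\<le>n. (of_nat (n choose j))\<^sup>2 * (y\<^sup>2) ^ j)"
  proof (rule sum.cong[OF refl])
    fix j assume "j \<in> {..n}"
    then have j: "j \<le> n" by simp
    then have "coeff ([:1, - y:] ^ n) j * coeff ([:- y, 1:] ^ n) (n - j)
        = (of_nat (n choose j))\<^sup>2 * ((- y) ^ j * (- y) ^ j)"
      by (simp add: coeff_linear_poly_power binomial_symmetric[symmetric] power2_eq_square)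
    also have "(- y) ^ j * (- y) ^ j = (y\<^sup>2) ^ j"
      by (simp add: power_mult_distrib [symmetric] power2_eq_square)
    finally show "coeff ([:1, - y:] ^ n) j * coeff ([:- y, 1:] ^ n) (n - j)
        = (of_nat (n choose j))\<^sup>2 * (y\<^sup>2) ^ j" .
  qed
  finally show ?thesis using L by simp
qed

text \<open>Homogenized so that a fraction such as 1/2 can be represented by the integers 1, 2. For
  \<open>b = 1\<close> and n = (p - 1)/2 its reduction modulo p is the Hasse polynomial of the
  Legendre family of elliptic curves.\<close>

definition sq_binomial_form :: "nat \<Rightarrow> int \<Rightarrow> int \<Rightarrow> int" where
  "sq_binomial_form n a b = (\<Sum>k\<le>n. (of_nat (n choose k))\<^sup>2 * (a ^ k * b ^ (n - k)))"

lemma sq_binomial_form_swap: "sq_binomial_form n a b = sq_binomial_form n b a"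
  unfolding sq_binomial_form_def
  by (rule sum.reindex_bij_witness[where i = "\<lambda>k. n - k" and j = "\<lambda>k. n - k"])
     (auto simp: binomial_symmetric[symmetric])

lemma sq_binomial_form_scale: "sq_binomial_form n (c * a) (c * b) = c ^ n * sq_binomial_form n a b"
proof -
  have "(c * a) ^ k * (c * b) ^ (n - k) = c ^ n * (a ^ k * b ^ (n - k))" if "k \<le> n" for k
  proof -
    have "(c * a) ^ k * (c * b) ^ (n - k) = c ^ (k + (n - k)) * (a ^ k * b ^ (n - k))"
      by (simp only: power_mult_distrib power_add mult_ac)
    then show ?thesis using that by simp
  qed
  then show ?thesis
    unfolding sq_binomial_form_def sum_distrib_left
    by (intro sum.cong) (auto simp: mult_ac)
qed

section \<open>The quadratic character of 2\<close>

text \<open>Gauss's lemma: with p = 8q + 7, the number of doubles exceeding p/2 is 2(q + 1), which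
  is even.\<close>

lemma two_is_square_mod_prime:
  assumes "prime p" and "[p = 7] (mod 8)"
  obtains s :: int where "[s\<^sup>2 = 2] (mod int p)"
proof -
  from assms(2) have "p mod 8 = 7" by (simp add: cong_def)
  then obtain q where q: "p = 8 * q + 7" by (metis mod_div_mult_eq add.commute mult.commute)
  interpret GAUSS p 2
  proof
    show "[2 \<noteq> 0] (mod int p)" using q by (auto simp: cong_0_iff dest!: zdvd_imp_le)
  qed (use assms(1) q in auto)
  have half: "(int p - 1) div 2 = 4 * int q + 3" using q by simp
  have C: "C = (\<lambda>x. x * 2) ` {0<..4 * int q + 3}"
  proof -
    have "C = (\<lambda>x. (x * 2) mod int p) ` {0<..4 * int q + 3}"
      by (simp add: C_def B_def A_def half image_image)
    \<comment> \<open>The doubles are at most 8q + 6 < p, so they are already reduced.\<close>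
    also have "\<dots> = (\<lambda>x. x * 2) ` {0<..4 * int q + 3}"
      by (rule image_cong) (auto simp: q)
    finally show ?thesis .
  qed
  have "E = (\<lambda>x. x * 2) ` {2 * int q + 2..4 * int q + 3}"
    unfolding E_def C half by (auto simp: image_iff)
  then have "card E = card {2 * int q + 2..4 * int q + 3}"
    by (simp add: card_image inj_on_def)
  also have "\<dots> = 2 * (q + 1)" by simp
  finally have "Legendre 2 (int p) = 1"
    using gauss_lemma by simp
  then have "QuadRes (int p) 2"
    by (auto simp: Legendre_def split: if_splits)
  then show ?thesis using that by (auto simp: QuadRes_def)
qed

section \<open>Rational numbers integral at p and their congruences\<close>

locale localization_at_prime =
  fixes p :: nat
  assumes prime_p: "prime p"
begin

text \<open>The localization of the integers at the prime ideal (p), inside the rationals; not the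
  ring of p-adic integers.\<close>

definition Zp :: "rat set" where
  "Zp = {of_int a / of_int b | a b. coprime b (int p)}"

text \<open>Only the difference is constrained, so integrality of \<open>r\<close> and
  \<open>s\<close> is tracked separately.\<close>

definition zcong :: "nat \<Rightarrow> rat \<Rightarrow> rat \<Rightarrow> bool" where
  "zcong m r s \<longleftrightarrow> (\<exists>z\<in>Zp. r - s = of_nat m * z)"

lemma coprime_p_nonzero: "coprime b (int p) \<Longrightarrow> b \<noteq> 0"
  using prime_p by (auto simp: prime_nat_iff)

lemma coprime_p_if_less: "0 < k \<Longrightarrow> k < p \<Longrightarrow> coprime (int k) (int p)"
  using prime_imp_coprime_nat[OF prime_p, of k] nat_dvd_not_less[of k p] by (auto simp: coprime_commute)

lemma Zp_quotient: "coprime b (int p) \<Longrightarrow> of_int a / of_int b \<in> Zp"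
  by (auto simp: Zp_def)

lemma of_int_in_Zp [simp]: "of_int a \<in> Zp"
  using Zp_quotient[of 1 a] by simp

lemma of_nat_in_Zp [simp]: "of_nat a \<in> Zp"
  using of_int_in_Zp[of "int a"] by simp

lemma inverse_nat_in_Zp: "0 < k \<Longrightarrow> k < p \<Longrightarrow> 1 / of_nat k \<in> Zp"
  using Zp_quotient[OF coprime_p_if_less, of k 1] by simp

lemma Zp_add [intro]: "r \<in> Zp \<Longrightarrow> s \<in> Zp \<Longrightarrow> r + s \<in> Zp"
proof -
  assume "r \<in> Zp" "s \<in> Zp"
  then obtain a b c d where "r = of_int a / of_int b" "s = of_int c / of_int d"
    and cop: "coprime b (int p)" "coprime d (int p)" by (auto simp: Zp_def)
  then have "r + s = of_int (a * d + c * b) / of_int (b * d)"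
    using cop[THEN coprime_p_nonzero] by (simp add: add_frac_eq)
  then show "r + s \<in> Zp" using cop by (auto intro: Zp_quotient simp del: of_int_mult of_int_add)
qed

lemma Zp_mult [intro]: "r \<in> Zp \<Longrightarrow> s \<in> Zp \<Longrightarrow> r * s \<in> Zp"
proof -
  assume "r \<in> Zp" "s \<in> Zp"
  then obtain a b c d where "r = of_int a / of_int b" "s = of_int c / of_int d"
    and cop: "coprime b (int p)" "coprime d (int p)" by (auto simp: Zp_def)
  then have "r * s = of_int (a * c) / of_int (b * d)" by simp
  then show "r * s \<in> Zp" using cop by (auto intro: Zp_quotient simp del: of_int_mult)
qed

lemma Zp_minus [intro]: "r \<in> Zp \<Longrightarrow> - r \<in> Zp"
  using Zp_mult[of r "of_int (- 1)"] of_int_in_Zp[of "- 1"] by simp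

lemma Zp_diff [intro]: "r \<in> Zp \<Longrightarrow> s \<in> Zp \<Longrightarrow> r - s \<in> Zp"
  using Zp_add[of r "- s"] by auto

lemma Zp_sum [intro]: "(\<And>x. x \<in> A \<Longrightarrow> f x \<in> Zp) \<Longrightarrow> sum f A \<in> Zp"
  using of_int_in_Zp[of 0] by (induction A rule: infinite_finite_induct) auto

lemma Zp_power [intro]: "r \<in> Zp \<Longrightarrow> r ^ n \<in> Zp"
  using of_int_in_Zp[of 1] by (induction n) auto

lemma zcongI: "z \<in> Zp \<Longrightarrow> r - s = of_nat m * z \<Longrightarrow> zcong m r s"
  by (auto simp: zcong_def)

lemma zcongE:
  assumes "zcong m r s"
  obtains z where "z \<in> Zp" "r = s + of_nat m * z"
  using assms by (auto simp: zcong_def algebra_simps)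

lemma zcong_refl [simp]: "zcong m r r"
  by (rule zcongI[of 0]) (use of_int_in_Zp[of 0] in auto)

lemma zcong_sym: "zcong m r s \<Longrightarrow> zcong m s r"
  by (erule zcongE, rule zcongI[OF Zp_minus]) auto

lemma zcong_add:
  assumes "zcong m r s" "zcong m t u"
  shows "zcong m (r + t) (s + u)"
proof -
  obtain y z where "y \<in> Zp" "r = s + of_nat m * y" "z \<in> Zp" "t = u + of_nat m * z"
    using assms by (elim zcongE)
  then show ?thesis by (intro zcongI[OF Zp_add[of y z]]) (auto simp: algebra_simps)
qed

lemma zcong_trans [trans]:
  assumes "zcong m r s" "zcong m s t"
  shows "zcong m r t"
  using zcong_add[OF assms] unfolding zcong_def by simp

lemma zcong_mult_left:
  assumes "zcong m r s" "t \<in> Zp"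
  shows "zcong m (t * r) (t * s)"
proof -
  obtain z where "z \<in> Zp" "r = s + of_nat m * z"
    using assms by (elim zcongE)
  then show ?thesis using assms(2) by (intro zcongI[OF Zp_mult[of t z]]) (auto simp: algebra_simps)
qed

lemma zcong_mult:
  assumes "zcong m r s" "zcong m t u" "s \<in> Zp" "t \<in> Zp"
  shows "zcong m (r * t) (s * u)"
  using zcong_trans[OF zcong_mult_left[OF assms(1,4)], of "s * u"] zcong_mult_left[OF assms(2,3)]
  by (simp add: mult.commute)

lemma zcong_sum: "(\<And>x. x \<in> A \<Longrightarrow> zcong m (f x) (g x)) \<Longrightarrow> zcong m (sum f A) (sum g A)"
  by (induction A rule: infinite_finite_induct) (auto intro: zcong_add)

lemma zcong_Zp: "zcong m r s \<Longrightarrow> s \<in> Zp \<Longrightarrow> r \<in> Zp"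
  by (erule zcongE) (auto intro!: Zp_add Zp_mult)

lemma zcong_of_int: "[a = b] (mod int m) \<Longrightarrow> zcong m (of_int a) (of_int b)"
proof -
  assume "[a = b] (mod int m)"
  then obtain c where "a - b = int m * c" by (auto simp: cong_iff_dvd_diff)
  then have "rat_of_int (a - b) = of_nat m * of_int c" by simp
  then show ?thesis by (intro zcongI[of "of_int c"]) auto
qed

lemma zcong_cancel_int:
  assumes "zcong m (of_int c * r) 0" and "coprime c (int p)"
  shows "zcong m r 0"
proof -
  have "1 / of_int c \<in> Zp" using Zp_quotient[OF assms(2), of 1] by simp
  from zcong_mult_left[OF assms(1) this] show ?thesis
    using coprime_p_nonzero[OF assms(2)] by simp
qed

text \<open>Passage to lowest terms: clearing denominators gives u b = p^e a v with b prime to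
  p.\<close>

lemma dvd_numerator:
  assumes "zcong (p ^ e) r s" and "quotient_of (r - s) = (u, v)"
  shows "int p ^ e dvd u"
proof -
  from assms(1) obtain a b where ab: "r - s = of_nat (p ^ e) * (of_int a / of_int b)"
    and cop: "coprime b (int p)" by (auto simp: zcong_def Zp_def)
  have "v > 0" using assms(2) by (rule quotient_of_denom_pos)
  with quotient_of_div[OF assms(2)] ab coprime_p_nonzero[OF cop]
  have "rat_of_int (u * b) = of_int (int p ^ e * (a * v))"
    by (simp add: field_simps)
  then have "u * b = int p ^ e * (a * v)" by (simp only: of_int_eq_iff)
  then have "int p ^ e dvd u * b" by simp
  moreover have "coprime (int p ^ e) b" using cop by (simp add: coprime_commute)
  ultimately show ?thesis by (simp only: coprime_dvd_mult_left_iff)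
qed

lemma cong_of_zcong:
  assumes "zcong p (of_int a) (of_int b)"
  shows "[a = b] (mod int p)"
  using dvd_numerator[of 1 "of_int a" "of_int b" "a - b" 1] assms
  by (simp add: cong_iff_dvd_diff flip: of_int_diff)

text \<open>The reduced denominator divides the denominator of every other representation, in
  particular one prime to p.\<close>

lemma coprime_denominator:
  assumes "r \<in> Zp"
  shows "coprime (snd (quotient_of r)) (int p)"
proof -
  obtain u v where uv: "quotient_of r = (u, v)" by force
  from assms obtain a b where ab: "r = of_int a / of_int b"
    and cop: "coprime b (int p)" by (auto simp: Zp_def)
  have "v > 0" using uv by (rule quotient_of_denom_pos)
  with quotient_of_div[OF uv] ab coprime_p_nonzero[OF cop]
  have "rat_of_int (u * b) = of_int (a * v)"
    by (simp add: field_simps)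
  then have "u * b = a * v" by (simp only: of_int_eq_iff)
  then have "v dvd u * b" by simp
  moreover have "coprime v u" using quotient_of_coprime[OF uv] by (simp add: coprime_commute)
  ultimately have "v dvd b" by (simp only: coprime_dvd_mult_right_iff)
  from coprime_divisors[OF this dvd_refl cop] show ?thesis using uv by simp
qed

lemma rat_cong_sqI:
  assumes "r \<in> Zp" "s \<in> Zp" "zcong (p\<^sup>2) r s"
  shows "rat_cong_sq p r s"
  using assms coprime_denominator dvd_numerator[of 2 r s]
  by (cases "quotient_of (r - s)") (auto simp: rat_cong_sq_def)

end

section \<open>The summands modulo p^2 and modulo p, for p = 2n + 1\<close>

locale localization_at_odd_prime = localization_at_prime +
  fixes n :: nat
  assumes p_eq: "p = 2 * n + 1"
begin

abbreviation "d \<equiv> beta_moment (Suc n)"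

lemma coprime_2_p: "coprime 2 (int p)"
  by (simp add: p_eq)

lemma inverse_4_in_Zp: "1 / 4 \<in> Zp"
proof -
  have "coprime (2 * 2) (int p)" using coprime_2_p by (simp only: coprime_mult_left_iff)
  then show ?thesis using Zp_quotient[of 4 1] by simp
qed

lemma d_Suc: "d (Suc k) = d k * (of_nat (n + 1 + k) / of_nat (p + 1 + k))"
  by (simp add: beta_moment_Suc p_eq add_ac)

text \<open>Modulo p the denominator is k + 1, which is a unit in this range.\<close>

lemma p_plus_in_Zp: "Suc k < p \<Longrightarrow> 1 / of_nat (p + 1 + k) \<in> Zp"
proof -
  assume k: "Suc k < p"
  have "int (p + 1 + k) = int (k + 1) + int p" by simp
  then have "coprime (int (p + 1 + k)) (int p)"
    using coprime_p_if_less[of "k + 1"] k by (simp only: coprime_iff_gcd_eq_1 gcd_add1)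
  from Zp_quotient[OF this, of 1] show ?thesis by simp
qed

lemma d_in_Zp: "k < p \<Longrightarrow> d k \<in> Zp"
proof (induction k)
  case (Suc k)
  then have "d k * (of_nat (n + 1 + k) * (1 / of_nat (p + 1 + k))) \<in> Zp"
    by (intro Zp_mult p_plus_in_Zp of_nat_in_Zp) auto
  then show ?case by (simp add: d_Suc)
qed (use of_int_in_Zp[of 1] in simp)

text \<open>The factor common to the three sums, once 1/4^k is written as 4^k/16^k in the first; the
  remaining weights are integers.\<close>

definition T :: "nat \<Rightarrow> rat" where
  "T k = of_nat ((p - 1) choose k) * of_nat ((2 * k) choose k) ^ 2 / 16 ^ k"

text \<open>The ratios of consecutive terms on the two sides are
  $\frac{(p-1-k)(2k+1)^2}{4(k+1)^3}$ and $\frac{p^2-(2k+1)^2}{4(k+1)(p+1+k)}$.\<close>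

lemma T_zcong:
  assumes "k < p"
  shows "zcong (p\<^sup>2) (T k) (of_nat (n choose k) * d k)"
  using assms
proof (induction k)
  case 0
  show ?case by (simp add: T_def)
next
  case (Suc k)
  define P K where "P = rat_of_nat p" and "K = rat_of_nat k"
  have nonneg: "P \<ge> 0" "K \<ge> 0" by (auto simp: P_def K_def)
  then have nonzero: "K + 1 \<noteq> 0" "P + 1 + K \<noteq> 0" by auto
  have n: "of_nat n = (P - 1) / 2" by (simp add: P_def p_eq)
  have p1: "rat_of_nat (p - 1) = P - 1" using p_eq by (simp add: P_def)
  have K1: "rat_of_nat (Suc k) = K + 1" "rat_of_nat (p + 1 + k) = P + 1 + K"
    by (simp_all add: K_def P_def)
  \<comment> \<open>The two ratios, with divisions written as multiplication by inverses of units so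
    that the closure rules of \<open>Zp\<close> apply.\<close>
  define A B where "A = (P - 1 - K) * (2 * K + 1)\<^sup>2 * (1 / 4) * (1 / (K + 1)) ^ 3"
    and "B = (P\<^sup>2 - (2 * K + 1)\<^sup>2) * (1 / 4) * (1 / (K + 1)) * (1 / (P + 1 + K))"
  have A: "(P - 1 - K) / (K + 1) * (2 * (2 * K + 1) / (K + 1))\<^sup>2 / 16 = A"
    unfolding A_def using nonzero
    by (simp add: power2_eq_square power3_eq_cube divide_simps) (simp add: algebra_simps)
  have T: "T (Suc k) = T k * A"
    unfolding T_def of_nat_central_binomial_Suc
    unfolding of_nat_binomial_Suc p1 K1
    using nonzero by (simp add: A [symmetric] K_def [symmetric] power2_eq_square divide_simps)
      (simp add: algebra_simps)
  have "((P - 1) / 2 - K) / (K + 1) * (((P - 1) / 2 + 1 + K) / (P + 1 + K)) = B"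
    unfolding B_def using nonzero by (simp add: power2_eq_square divide_simps) (simp add: algebra_simps)
  from this [symmetric] have S: "of_nat (n choose Suc k) * d (Suc k) = of_nat (n choose k) * d k * B"
    unfolding of_nat_binomial_Suc d_Suc K1 by (simp add: n K_def [symmetric] mult_ac add_ac)
  have Zp: "P \<in> Zp" "K \<in> Zp" "1 \<in> Zp" "2 \<in> Zp"
    using of_int_in_Zp[of 1] of_int_in_Zp[of 2] by (simp_all add: P_def K_def)
  note Zp = Zp inverse_4_in_Zp inverse_nat_in_Zp[OF zero_less_Suc Suc.prems, unfolded K1]
    p_plus_in_Zp[OF Suc.prems, unfolded K1]
  have "zcong (p\<^sup>2) A B"
  proof (rule zcongI)
    \<comment> \<open>Over the denominator 4 (K+1)^3 (P+1+K) the difference has numerator (P^2 -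
      (K+1)^2)(2K+1)^2 - (P^2 - (2K+1)^2)(K+1)^2; the terms free of P cancel.\<close>
    show "((2 * K + 1)\<^sup>2 - (K + 1)\<^sup>2) * (1 / 4) * (1 / (K + 1)) ^ 3 * (1 / (P + 1 + K)) \<in> Zp"
      by (intro Zp_mult Zp_diff Zp_power Zp_add Zp)
    have "A - B = P\<^sup>2 * (((2 * K + 1)\<^sup>2 - (K + 1)\<^sup>2) * (1 / 4) * (1 / (K + 1)) ^ 3 * (1 / (P + 1 + K)))"
      unfolding A_def B_def using nonzero
      by (simp add: power2_eq_square power3_eq_cube divide_simps) (simp add: algebra_simps)
    then show "A - B = of_nat (p\<^sup>2) * (((2 * K + 1)\<^sup>2 - (K + 1)\<^sup>2) * (1 / 4) * (1 / (K + 1)) ^ 3 * (1 / (P + 1 + K)))"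
      by (simp add: P_def)
  qed
  moreover have "A \<in> Zp"
    unfolding A_def by (intro Zp_mult Zp_diff Zp_power Zp_add Zp)
  moreover have "of_nat (n choose k) * d k \<in> Zp"
    using Suc.prems by (intro Zp_mult d_in_Zp) auto
  ultimately show ?case
    unfolding T S using Suc by (intro zcong_mult) auto
qed

text \<open>Since n + 1 \<equiv> -n modulo p, the ratio (n+1+k)/(p+1+k) is congruent to
  -(n-k)/(k+1).\<close>

lemma d_zcong:
  assumes "k < p"
  shows "zcong p (d k) (of_int ((- 1) ^ k * int (n choose k)))"
  using assms
proof (induction k)
  case 0
  show ?case by simp
next
  case (Suc k)
  define N K where "N = rat_of_nat n" and "K = rat_of_nat k"
  have nonneg: "N \<ge> 0" "K \<ge> 0" by (auto simp: N_def K_def)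
  then have nonzero: "K + 1 \<noteq> 0" "2 * N + 2 + K \<noteq> 0" by auto
  have K1: "rat_of_nat (Suc k) = K + 1" "rat_of_nat (p + 1 + k) = 2 * N + 2 + K" "rat_of_nat (n + 1 + k) = N + 1 + K"
    by (simp_all add: K_def N_def p_eq)
  have Zp: "1 \<in> Zp" "N \<in> Zp" "K \<in> Zp"
    using of_int_in_Zp[of 1] by (simp_all add: N_def K_def)
  note Zp = Zp inverse_nat_in_Zp[OF zero_less_Suc Suc.prems, unfolded K1]
    p_plus_in_Zp[OF Suc.prems, unfolded K1]
  let ?A = "(N + 1 + K) * (1 / (2 * N + 2 + K))" and ?B = "- ((N - K) * (1 / (K + 1)))"
  have "?A - ?B = of_nat p * ((N + 1) * (1 / (K + 1)) * (1 / (2 * N + 2 + K)))"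
    unfolding p_eq using nonzero by (simp add: N_def [symmetric] divide_simps) (simp add: algebra_simps)
  then have "zcong p ?A ?B"
    by (rule zcongI[rotated]) (intro Zp_mult Zp_add Zp)
  moreover have "?A \<in> Zp" by (intro Zp_mult Zp_add Zp)
  ultimately have "zcong p (d k * ?A) (of_int ((- 1) ^ k * int (n choose k)) * ?B)"
    using Suc by (intro zcong_mult[OF _ _ of_int_in_Zp]) auto
  moreover have "d (Suc k) = d k * ?A"
    unfolding d_Suc K1 by simp
  moreover have "of_int ((- 1) ^ Suc k * int (n choose Suc k)) = of_int ((- 1) ^ k * int (n choose k)) * ?B"
    using of_nat_binomial_Suc[of n k] unfolding K1
    by (simp add: N_def K_def)
  ultimately show ?case by simp
qed

text \<open>The central binomial coefficient is (-4)^k times the binomial coefficient of -1/2 over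
  k, and n \<equiv> -1/2 modulo p.\<close>

lemma central_binomial_cong:
  assumes "k < p"
  shows "[int ((2 * k) choose k) = (- 4) ^ k * int (n choose k)] (mod int p)"
proof -
  have "zcong p (of_int (int ((2 * k) choose k))) (of_int ((- 4) ^ k * int (n choose k)))"
    using assms
  proof (induction k)
    case 0
    show ?case by simp
  next
    case (Suc k)
    define N K where "N = rat_of_nat n" and "K = rat_of_nat k"
    have nonneg: "N \<ge> 0" "K \<ge> 0" by (auto simp: N_def K_def)
    then have nonzero: "K + 1 \<noteq> 0" by auto
    have K1: "rat_of_nat (Suc k) = K + 1"
      by (simp add: K_def)
    have Zp: "1 \<in> Zp" "2 \<in> Zp" "N \<in> Zp" "K \<in> Zp"
      using of_int_in_Zp[of 1] of_int_in_Zp[of 2] by (simp_all add: N_def K_def)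
    note Zp = Zp inverse_nat_in_Zp[OF zero_less_Suc Suc.prems, unfolded K1]
    let ?A = "2 * (2 * K + 1) * (1 / (K + 1))" and ?B = "- 4 * ((N - K) * (1 / (K + 1)))"
    have "?A - ?B = of_nat p * (2 * (1 / (K + 1)))"
      unfolding p_eq using nonzero by (simp add: N_def [symmetric] divide_simps)
    then have "zcong p ?A ?B"
      by (rule zcongI[rotated]) (intro Zp_mult Zp_add Zp)
    moreover have "?A \<in> Zp" by (intro Zp_mult Zp_add Zp)
    ultimately have "zcong p (of_int (int ((2 * k) choose k)) * ?A) (of_int ((- 4) ^ k * int (n choose k)) * ?B)"
      using Suc by (intro zcong_mult[OF _ _ of_int_in_Zp]) auto
    moreover have "of_int (int ((2 * Suc k) choose Suc k)) = of_int (int ((2 * k) choose k)) * ?A"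
      using of_nat_central_binomial_Suc[of k] unfolding K1
      by (simp add: K_def del: mult_Suc_right binomial_Suc_Suc)
    moreover have "of_int ((- 4) ^ Suc k * int (n choose Suc k)) = of_int ((- 4) ^ k * int (n choose k)) * ?B"
      by (simp only: of_int_mult of_int_of_nat_eq of_nat_binomial_Suc K1 power_Suc
          N_def [symmetric] K_def [symmetric]) (simp add: algebra_simps diff_divide_distrib)
    ultimately show ?case by simp
  qed
  then show ?thesis by (rule cong_of_zcong)
qed

lemma T_in_Zp: "k < p \<Longrightarrow> T k \<in> Zp"
  by (rule zcong_Zp[OF T_zcong]) (auto intro!: Zp_mult d_in_Zp)

text \<open>Reduces the three congruences to sums of Beta moments; the range shrinks because the
  binomial coefficients of \<open>n\<close> vanish beyond \<open>n\<close>.\<close>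

lemma sum_T_zcong:
  fixes c :: "nat \<Rightarrow> int"
  shows "zcong (p\<^sup>2) (\<Sum>k = 0..p - 1. T k * of_int (c k)) (\<Sum>k\<le>n. of_nat (n choose k) * d k * of_int (c k))"
proof -
  have "zcong (p\<^sup>2) (\<Sum>k = 0..p - 1. T k * of_int (c k)) (\<Sum>k = 0..p - 1. of_nat (n choose k) * d k * of_int (c k))"
  proof (rule zcong_sum)
    fix k assume "k \<in> {0..p - 1}"
    then have "k < p" using p_eq by auto
    from zcong_mult_left[OF T_zcong[OF this], of "of_int (c k)"]
    show "zcong (p\<^sup>2) (T k * of_int (c k)) (of_nat (n choose k) * d k * of_int (c k))"
      by (simp add: mult.commute)
  qed
  also have "(\<Sum>k = 0..p - 1. of_nat (n choose k) * d k * of_int (c k)) = (\<Sum>k\<le>n. of_nat (n choose k) * d k * of_int (c k))"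
    by (rule sum.mono_neutral_right) (auto simp: p_eq binomial_eq_0)
  finally show ?thesis .
qed

lemma sum_T_in_Zp: "(\<Sum>k = 0..p - 1. T k * of_int (c k)) \<in> Zp"
  using p_eq by (intro Zp_sum Zp_mult T_in_Zp of_int_in_Zp) auto

section \<open>The polynomial F and its reduction modulo p\<close>

abbreviation F :: "int \<Rightarrow> rat" where
  "F x \<equiv> \<Sum>k\<le>n. of_nat (n choose k) * d k * of_int ((- x) ^ k)"

lemma F_transform: "F x = (\<Sum>k\<le>n. of_nat (n choose k) * d k * of_int (x ^ k * (1 - x) ^ (n - k)))"
  using beta_moment_transform[of "Suc n" n "of_int x :: rat"] by simp

lemma binomial_d_zcong:
  assumes "k \<le> n"
  shows "zcong p (of_nat (n choose k) * d k * of_int c) (of_int ((int (n choose k))\<^sup>2 * ((- 1) ^ k * c)))"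
proof -
  have "zcong p (of_int (int (n choose k) * c) * d k)
     (of_int (int (n choose k) * c) * of_int ((- 1) ^ k * int (n choose k)))"
    using assms p_eq by (intro zcong_mult_left d_zcong of_int_in_Zp) auto
  then show ?thesis by (simp add: power2_eq_square mult_ac)
qed

lemma F_zcong_form: "zcong p (F x) (of_int (sq_binomial_form n x 1))"
proof -
  have "zcong p (F x) (\<Sum>k\<le>n. of_int ((int (n choose k))\<^sup>2 * ((- 1) ^ k * (- x) ^ k)))"
    by (intro zcong_sum binomial_d_zcong) auto
  also have "(\<Sum>k\<le>n. rat_of_int ((int (n choose k))\<^sup>2 * ((- 1) ^ k * (- x) ^ k))) = of_int (sq_binomial_form n x 1)"
    unfolding sq_binomial_form_def of_int_sum by (intro sum.cong) (auto simp flip: power_mult_distrib)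
  finally show ?thesis .
qed

lemma F_zcong_form': "zcong p (F x) (of_int (sq_binomial_form n (- x) (1 - x)))"
proof -
  have "zcong p (F x) (\<Sum>k\<le>n. of_int ((int (n choose k))\<^sup>2 * ((- 1) ^ k * (x ^ k * (1 - x) ^ (n - k)))))"
    unfolding F_transform by (intro zcong_sum binomial_d_zcong) auto
  also have "(\<Sum>k\<le>n. rat_of_int ((int (n choose k))\<^sup>2 * ((- 1) ^ k * (x ^ k * (1 - x) ^ (n - k)))))
      = of_int (sq_binomial_form n (- x) (1 - x))"
    unfolding sq_binomial_form_def of_int_sum
    by (intro sum.cong) (auto simp: power_minus[of x])
  finally show ?thesis .
qed

text \<open>F(y) has two reductions modulo p, one from its definition and one from
  \<open>F_transform\<close>. For y = x and y = 1 - x the second ones differ only by a swap and the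
  scaling by -1.\<close>

lemma sq_binomial_form_reflect:
  "[sq_binomial_form n (1 - x) 1 = (- 1) ^ n * sq_binomial_form n x 1] (mod int p)"
proof -
  have *: "[sq_binomial_form n y 1 = sq_binomial_form n (- y) (1 - y)] (mod int p)" for y
    by (rule cong_of_zcong, rule zcong_trans[OF zcong_sym[OF F_zcong_form] F_zcong_form'])
  have "sq_binomial_form n (- (1 - x)) (1 - (1 - x)) = (- 1) ^ n * sq_binomial_form n (- x) (1 - x)"
    using sq_binomial_form_scale[of n "- 1" "1 - x" "- x"] by (simp add: sq_binomial_form_swap)
  with *[of "1 - x"] cong_scalar_left[OF *[of x], of "(- 1) ^ n"] show ?thesis
    by (metis cong_sym cong_trans)
qed

text \<open>\<open>central_binomial_cong\<close> turns the exact Landen identity into one between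
  squared binomial sums; the signs of (-4)^j and (-y)^j cancel.\<close>

lemma sq_binomial_form_landen:
  "[sq_binomial_form n (y\<^sup>2) 1 = sq_binomial_form n (4 * y) ((1 + y)\<^sup>2)] (mod int p)"
proof -
  have "sq_binomial_form n (y\<^sup>2) 1 =
      (\<Sum>j\<le>n. int (n choose j) * int ((2 * j) choose j) * (- y) ^ j * ((1 + y)\<^sup>2) ^ (n - j))"
    unfolding landen_binomial_sum by (simp add: sq_binomial_form_def)
  also have "[\<dots> = (\<Sum>j\<le>n. int (n choose j) * ((- 4) ^ j * int (n choose j)) * (- y) ^ j * ((1 + y)\<^sup>2) ^ (n - j))] (mod int p)"
    using p_eq by (intro cong_sum cong_mult cong_refl central_binomial_cong) auto
  also have "(\<Sum>j\<le>n. int (n choose j) * ((- 4) ^ j * int (n choose j)) * (- y) ^ j * ((1 + y)\<^sup>2) ^ (n - j))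
      = sq_binomial_form n (4 * y) ((1 + y)\<^sup>2)"
    unfolding sq_binomial_form_def
    by (intro sum.cong) (auto simp: power_mult_distrib power_minus[of 4] power_minus[of y] power2_eq_square)
  finally show ?thesis .
qed

text \<open>The points $v^2$ with $(1 + v)^2 = 8v$, that is $v = 3 \pm 2\sqrt{2}$, are mapped by
  Landen's transformation to $1/2$, the fixed point of $x \mapsto 1 - x$.\<close>

lemma sq_binomial_form_vanishes:
  assumes "odd n" and "[(1 + v)\<^sup>2 = 8 * v] (mod int p)" and "[1 - x = v\<^sup>2] (mod int p)"
  shows "[sq_binomial_form n x 1 = 0] (mod int p)"
proof -
  have cong_form: "[a = a'] (mod int p) \<Longrightarrow> [b = b'] (mod int p) \<Longrightarrow>
      [sq_binomial_form n a b = sq_binomial_form n a' b'] (mod int p)" for a a' b b'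
    unfolding sq_binomial_form_def by (intro cong_sum cong_mult cong_pow cong_refl)
  \<comment> \<open>At -1 the swap and the scaling by -1 make the value its own negative, as
    \<open>n\<close> is odd. Reflection carries -1 to 2, and the swap carries 2 to 1/2.\<close>
  have "sq_binomial_form n (- 1) 1 = 0"
    using sq_binomial_form_scale[of n "- 1" "- 1" 1] assms(1)
    by (simp add: sq_binomial_form_swap[of n 1])
  with sq_binomial_form_reflect[of "- 1"] have "[sq_binomial_form n 1 2 = 0] (mod int p)"
    by (simp add: sq_binomial_form_swap[of n 1])
  from cong_scalar_left[OF this, of "(4 * v) ^ n"]
  have zero: "[sq_binomial_form n (4 * v) (8 * v) = 0] (mod int p)"
    using sq_binomial_form_scale[of n "4 * v" 1 2] by simp
  have "[sq_binomial_form n (1 - x) 1 = sq_binomial_form n (v\<^sup>2) 1] (mod int p)"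
    by (intro cong_form assms cong_refl)
  also note sq_binomial_form_landen
  also have "[sq_binomial_form n (4 * v) ((1 + v)\<^sup>2) = sq_binomial_form n (4 * v) (8 * v)] (mod int p)"
    by (intro cong_form assms cong_refl)
  also note zero
  finally have "[(- 1) ^ n * sq_binomial_form n x 1 = 0] (mod int p)"
    using sq_binomial_form_reflect[of x] by (metis cong_sym cong_trans)
  then show ?thesis using assms(1) by (simp add: cong_0_iff)
qed

end

section \<open>Cube roots of unity, square roots modulo p^2 and Binet formulas\<close>

lemma obtain_omega:
  obtains w :: complex where "w\<^sup>2 + w + 1 = 0" "w ^ 3 = 1" "w \<noteq> w\<^sup>2"
proof
  define w where "w = Complex (- 1 / 2) (sqrt 3 / 2)"
  show w: "w\<^sup>2 + w + 1 = 0"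
    by (simp add: w_def complex_eq_iff power2_eq_square)
  have "w ^ 3 - 1 = (w - 1) * (w\<^sup>2 + w + 1)"
    by (simp add: power2_eq_square power3_eq_cube algebra_simps)
  then show "w ^ 3 = 1" using w by simp
  show "w \<noteq> w\<^sup>2"
    by (auto simp: w_def complex_eq_iff power2_eq_square)
qed

lemma square_root_lift:
  fixes s :: int
  assumes "[s\<^sup>2 = a] (mod int p)" "coprime (2 * s) (int p)"
  obtains t where "[t\<^sup>2 = a] (mod (int p)\<^sup>2)"
proof -
  obtain m where m: "s\<^sup>2 - a = int p * m"
    using assms(1) by (auto simp: cong_iff_dvd_diff)
  obtain y where y: "[2 * s * y = 1] (mod int p)"
    using cong_solve_coprime_int[OF assms(2)] by auto
  then obtain q where q: "2 * s * y - 1 = int p * q"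
    by (auto simp: cong_iff_dvd_diff)
  \<comment> \<open>A Newton step: \<open>y\<close> inverts the derivative 2s modulo p, and p m is
    the error s^2 - a.\<close>
  let ?t = "s - int p * (y * m)"
  have "?t\<^sup>2 - a = (s\<^sup>2 - a) - int p * m * (2 * s * y) + (int p)\<^sup>2 * (y * m)\<^sup>2"
    by (simp add: power2_eq_square algebra_simps)
  also have "\<dots> = int p * m - int p * m * (1 + int p * q) + (int p)\<^sup>2 * (y * m)\<^sup>2"
    using m q by (simp add: algebra_simps)
  also have "\<dots> = (int p)\<^sup>2 * ((y * m)\<^sup>2 - m * q)"
    by (simp add: power2_eq_square algebra_simps)
  finally have "[?t\<^sup>2 = a] (mod (int p)\<^sup>2)"
    by (simp add: cong_iff_dvd_diff)
  then show ?thesis by (rule that)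
qed

text \<open>By Vieta, \<open>x\<close> and \<open>y\<close> are the roots of z^2 = 3z - 3;
  multiplying by \<open>x - y\<close> avoids division.\<close>

lemma M_binet:
  fixes x y :: "'a::comm_ring_1"
  assumes "x + y = 3" "x * y = 3"
  shows "(x - y) * of_int (M k) = x ^ k - y ^ k"
proof (induction k rule: M.induct)
  case (3 k)
  have root: "z ^ Suc (Suc k) = 3 * z ^ Suc k - 3 * z ^ k" if "z * z = 3 * z - 3" for z :: 'a
  proof -
    have "z ^ Suc (Suc k) = z ^ k * (z * z)" by (simp add: mult_ac)
    then show ?thesis unfolding that by (simp add: algebra_simps)
  qed
  have "x * x = (x + y) * x - x * y" "y * y = (x + y) * y - x * y"
    by (simp_all add: algebra_simps)
  then have "x ^ Suc (Suc k) - y ^ Suc (Suc k) = 3 * (x ^ Suc k - y ^ Suc k) - 3 * (x ^ k - y ^ k)"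
    unfolding assms by (simp only: root) (simp add: algebra_simps)
  also have "\<dots> = (x - y) * of_int (M (Suc (Suc k)))"
    unfolding 3 [symmetric] by (simp add: algebra_simps)
  finally show ?case ..
qed auto

text \<open>Modulo \<open>m\<close>, the numbers 4 + 3s and 4 - 3s are roots of z^2 = 8z + 2, with
  difference 6s.\<close>

lemma W_binet_cong:
  fixes s :: int
  assumes "[s\<^sup>2 = 2] (mod m)"
  shows "[6 * s * W k = (4 + 3 * s) ^ k - (4 - 3 * s) ^ k] (mod m)"
proof (induction k rule: W.induct)
  case (3 k)
  let ?x = "4 + 3 * s" and ?y = "4 - 3 * s"
  have "?x ^ Suc (Suc k) - ?y ^ Suc (Suc k) - (8 * (?x ^ Suc k - ?y ^ Suc k) + 2 * (?x ^ k - ?y ^ k))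
      = 9 * (?x ^ k - ?y ^ k) * (s\<^sup>2 - 2)"
    by (simp add: power2_eq_square algebra_simps)
  then have "[?x ^ Suc (Suc k) - ?y ^ Suc (Suc k) = 8 * (?x ^ Suc k - ?y ^ Suc k) + 2 * (?x ^ k - ?y ^ k)] (mod m)"
    using assms by (simp add: cong_iff_dvd_diff del: power_Suc)
  moreover have "[8 * (6 * s * W (Suc k)) + 2 * (6 * s * W k)
      = 8 * (?x ^ Suc k - ?y ^ Suc k) + 2 * (?x ^ k - ?y ^ k)] (mod m)"
    by (intro cong_add cong_scalar_left 3)
  ultimately have "[8 * (6 * s * W (Suc k)) + 2 * (6 * s * W k) = ?x ^ Suc (Suc k) - ?y ^ Suc (Suc k)] (mod m)"
    by (blast intro: cong_trans cong_sym)
  moreover have "6 * s * W (Suc (Suc k)) = 8 * (6 * s * W (Suc k)) + 2 * (6 * s * W k)"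
    by (simp add: algebra_simps)
  ultimately show ?case by (simp only:)
qed auto

section \<open>The weighted sums of Beta moments\<close>

context localization_at_odd_prime
begin

text \<open>For x = 1 - w and y = 1 - w^2 Binet's formula makes (x - y) times the sum equal to F(x)
  - F(y). Here x + y = x y, and (1 - x)^n = w^n = 1 because 3 divides \<open>n\<close>.\<close>

lemma sum_M_eq_0:
  assumes "3 dvd n"
  shows "(\<Sum>k\<le>n. of_nat (n choose k) * d k * of_int ((- 1) ^ k * M k)) = 0"
proof -
  obtain w :: complex where w: "w\<^sup>2 + w + 1 = 0" "w ^ 3 = 1" "w \<noteq> w\<^sup>2"
    by (rule obtain_omega)
  define x y where "x = 1 - w" and "y = 1 - w\<^sup>2"
  have w2: "w\<^sup>2 = - 1 - w" using w(1) by (simp add: eq_neg_iff_add_eq_0 algebra_simps)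
  have "x * y = 1 - w - w\<^sup>2 + w ^ 3"
    by (simp add: x_def y_def power2_eq_square power3_eq_cube algebra_simps)
  then have xy: "x + y = 3" "x * y = 3"
    by (simp_all add: x_def y_def w2 w(2))
  have "w ^ n = 1" using assms w(2) by (auto simp: power_mult)
  then have P: "(\<Sum>k\<le>n. of_nat (n choose k) * of_rat (d k) * (- x) ^ k)
      = (\<Sum>k\<le>n. of_nat (n choose k) * of_rat (d k) * (- y) ^ k)"
    using beta_moment_transform_conj[of "Suc n" x y n] xy by (simp add: x_def)
  have "(x - y) * of_rat (\<Sum>k\<le>n. of_nat (n choose k) * d k * of_int ((- 1) ^ k * M k))
     = (\<Sum>k\<le>n. of_nat (n choose k) * of_rat (d k) * ((- 1) ^ k * ((x - y) * of_int (M k))))"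
    by (simp add: of_rat_sum of_rat_mult of_rat_power sum_distrib_left mult_ac)
  also have "\<dots> = (\<Sum>k\<le>n. of_nat (n choose k) * of_rat (d k) * (- x) ^ k)
      - (\<Sum>k\<le>n. of_nat (n choose k) * of_rat (d k) * (- y) ^ k)"
    unfolding M_binet[OF xy] by (simp add: power_minus[of x] power_minus[of y] algebra_simps sum_subtractf)
  finally show ?thesis using P w(3) by (simp add: x_def y_def)
qed

text \<open>The weight 2, -1, -1 equals w^k + w^(2k), so the sum is F(-w) + F(-w^2). The functional
  equation has factor (1 + w)^n = (-w^2)^n = -1, by both conditions on \<open>n\<close>.\<close>

lemma sum_mod_3_eq_0:
  assumes "odd n" "3 dvd n"
  shows "(\<Sum>k\<le>n. of_nat (n choose k) * d k * of_int (if 3 dvd k then 2 else - 1)) = 0"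
proof -
  obtain w :: complex where w: "w\<^sup>2 + w + 1 = 0" "w ^ 3 = 1" "w \<noteq> w\<^sup>2"
    by (rule obtain_omega)
  have w2: "w\<^sup>2 = - 1 - w" using w(1) by (simp add: eq_neg_iff_add_eq_0 algebra_simps)
  have "1 + w = - w\<^sup>2" by (simp add: w2)
  moreover have "w ^ n = 1" using assms w(2) by (auto simp: power_mult)
  then have "(w\<^sup>2) ^ n = 1" by (simp add: power_mult [symmetric] mult.commute[of 2]) (simp add: power_mult)
  ultimately have pow: "(1 + w) ^ n = - 1" using assms(1) by simp
  have "- w * - (w\<^sup>2) = w ^ 3"
    by (simp add: power2_eq_square power3_eq_cube)
  then have "- w + - (w\<^sup>2) = - w * - (w\<^sup>2)"
    by (simp add: w2 w(2))
  from beta_moment_transform_conj[OF _ this, of "Suc n" n]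
  have P: "(\<Sum>k\<le>n. of_nat (n choose k) * of_rat (d k) * w ^ k)
      = - (\<Sum>k\<le>n. of_nat (n choose k) * of_rat (d k) * (w\<^sup>2) ^ k)"
    by (simp add: pow)
  have root: "of_int (if 3 dvd k then 2 else - 1) = w ^ k + (w\<^sup>2) ^ k" for k :: nat
  proof -
    define q where "q = k div 3"
    have eq: "w ^ k = w ^ (k mod 3)"
      by (subst mult_div_mod_eq[of 3 k, symmetric], simp only: power_add power_mult w(2)) simp
    have "(w\<^sup>2) ^ k = (w ^ (k mod 3))\<^sup>2"
      by (simp add: eq [symmetric] power_mult [symmetric] mult.commute)
    moreover have "k mod 3 = 0 \<or> k mod 3 = 1 \<or> k mod 3 = 2" by arith
    moreover have "(w\<^sup>2)\<^sup>2 = w" using w(2) by (simp add: power2_eq_square power3_eq_cube mult_ac)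
    ultimately show ?thesis using eq by (auto simp: w2 dvd_eq_mod_eq_0)
  qed
  have "of_rat (\<Sum>k\<le>n. of_nat (n choose k) * d k * of_int (if 3 dvd k then 2 else - 1))
     = (\<Sum>k\<le>n. of_nat (n choose k) * of_rat (d k) * (of_int (if 3 dvd k then 2 else - 1) :: complex))"
    by (simp only: of_rat_sum of_rat_mult of_rat_of_nat_eq of_rat_of_int_eq)
  also have "\<dots> = 0"
    unfolding root using P by (simp add: distrib_left sum.distrib)
  finally show ?thesis by simp
qed

text \<open>The analogue of \<open>beta_moment_transform_conj\<close> for integers that are related
  only modulo p^2.\<close>

lemma F_transform_cong:
  assumes "[x + x' = x * x'] (mod (int p)\<^sup>2)"
  shows "zcong (p\<^sup>2) (F x) (of_int ((1 - x) ^ n) * F x')"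
proof -
  have "zcong (p\<^sup>2) (of_nat (n choose k) * d k * of_int (x ^ k * (1 - x) ^ (n - k)))
      (of_nat (n choose k) * d k * of_int ((1 - x) ^ n * (- x') ^ k))" if "k \<le> n" for k
  proof (intro zcong_mult_left zcong_of_int)
    have "x - (1 - x) * (- x') = (x + x') - x * x'" by (simp add: algebra_simps)
    then have "[x = (1 - x) * (- x')] (mod int (p\<^sup>2))"
      using assms by (simp only: cong_iff_dvd_diff of_nat_power)
    from cong_scalar_right[OF cong_pow[OF this, of k], of "(1 - x) ^ (n - k)"]
    have "[x ^ k * (1 - x) ^ (n - k) = ((1 - x) * (- x')) ^ k * (1 - x) ^ (n - k)] (mod int (p\<^sup>2))" .
    also have "((1 - x) * (- x')) ^ k * (1 - x) ^ (n - k) = (1 - x) ^ (k + (n - k)) * (- x') ^ k"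
      by (simp only: power_mult_distrib power_add mult_ac)
    finally show "[x ^ k * (1 - x) ^ (n - k) = (1 - x) ^ n * (- x') ^ k] (mod int (p\<^sup>2))"
      using that by simp
    show "of_nat (n choose k) * d k \<in> Zp"
      using that p_eq by (intro Zp_mult of_nat_in_Zp d_in_Zp) auto
  qed
  then have "zcong (p\<^sup>2) (F x) (\<Sum>k\<le>n. of_nat (n choose k) * d k * of_int ((1 - x) ^ n * (- x') ^ k))"
    unfolding F_transform by (intro zcong_sum) auto
  then show ?thesis by (simp add: sum_distrib_left mult_ac)
qed

lemma fermat_even_power:
  assumes "coprime u (int p)"
  shows "[(u\<^sup>2) ^ n = 1] (mod int p)"
proof -
  have "\<not> int p dvd u"
  proof
    assume "int p dvd u"
    from coprime_common_divisor[OF assms this dvd_refl] show False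
      using prime_p by simp
  qed
  then have "\<not> p dvd nat \<bar>u\<bar>" by (simp add: int_dvd_int_iff [symmetric])
  from fermat_theorem[OF prime_p this] have "[int (nat \<bar>u\<bar> ^ (2 * n)) = int 1] (mod int p)"
    unfolding cong_int_iff by (simp add: p_eq)
  then show ?thesis by (simp add: power_mult)
qed

lemma sum_W_zcong_0:
  assumes "p mod 8 = 7"
  shows "zcong (p\<^sup>2) (\<Sum>k\<le>n. of_nat (n choose k) * d k * of_int (4 ^ k * W k)) 0"
proof -
  have cop_root: "coprime s (int p)" if "[s\<^sup>2 = 2] (mod int p)" for s
    using cong_imp_coprime[OF cong_sym[OF that] coprime_2_p] by simp
  obtain s0 :: int where s0: "[s0\<^sup>2 = 2] (mod int p)"
    using two_is_square_mod_prime[OF prime_p] assms by (auto simp: cong_def)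
  have "coprime (2 * s0) (int p)" using cop_root[OF s0] coprime_2_p by simp
  from square_root_lift[OF s0 this] obtain s where s: "[s\<^sup>2 = 2] (mod (int p)\<^sup>2)"
    by blast
  then have sp: "[s\<^sup>2 = 2] (mod int p)"
    by (rule cong_dvd_modulus) simp
  \<comment> \<open>The Binet factor 6s is a unit, so it can be cancelled at the end.\<close>
  have cop_s: "coprime (6 * s) (int p)"
    using coprime_p_if_less[of 6] cop_root[OF sp] assms by (cases "p = 7") auto
  \<comment> \<open>Chosen so that (-x)^k = 4^k (4 + 3s)^k, and likewise for \<open>y\<close> with 4
    - 3s.\<close>
  define x y where "x = - (16 + 12 * s)" and "y = - (16 - 12 * s)"
  have "x + y - x * y = 144 * (s\<^sup>2 - 2)"
    by (simp add: x_def y_def power2_eq_square algebra_simps)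
  then have "zcong (p\<^sup>2) (F x) (of_int ((1 - x) ^ n) * F y)"
    using s by (intro F_transform_cong) (simp only: cong_iff_dvd_diff dvd_mult)
  then obtain z where z: "z \<in> Zp" "F x = of_int ((1 - x) ^ n) * F y + of_nat (p\<^sup>2) * z"
    by (rule zcongE)
  txt \<open>The two factors of $((1 - x)^n - 1) F(y)$ are each divisible by $p$, so the product vanishes
    modulo $p^2$.\<close>
  have "[(1 - x) ^ n = 1] (mod int p)"
  proof -
    \<comment> \<open>Modulo p, 3 + 2s is a unit with inverse 3 - 2s, and 1 - x is its square, so
      Fermat's theorem applies.\<close>
    have "(3 + 2 * s) * (3 - 2 * s) - 1 = - 4 * (s\<^sup>2 - 2)"
      by (simp add: power2_eq_square algebra_simps)
    then have "[(3 + 2 * s) * (3 - 2 * s) = 1] (mod int p)"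
      using sp by (simp only: cong_iff_dvd_diff dvd_mult)
    then have "coprime (3 + 2 * s) (int p)"
      using coprime_iff_invertible_int by blast
    moreover have "(1 - x) - (3 + 2 * s)\<^sup>2 = - 4 * (s\<^sup>2 - 2)"
      by (simp add: x_def power2_eq_square algebra_simps)
    then have "[1 - x = (3 + 2 * s)\<^sup>2] (mod int p)"
      using sp by (simp only: cong_iff_dvd_diff dvd_mult)
    ultimately show ?thesis
      using cong_trans[OF cong_pow fermat_even_power] by blast
  qed
  then obtain q where q: "(1 - x) ^ n - 1 = int p * q"
    by (auto simp: cong_iff_dvd_diff)
  have "[sq_binomial_form n y 1 = 0] (mod int p)"
  proof (rule sq_binomial_form_vanishes)
    show "odd n" using assms p_eq by presburger
    have "(1 + (3 - 2 * s))\<^sup>2 - 8 * (3 - 2 * s) = 4 * (s\<^sup>2 - 2)" "(1 - y) - (3 - 2 * s)\<^sup>2 = - 4 * (s\<^sup>2 - 2)"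
      by (simp_all add: y_def power2_eq_square algebra_simps)
    then show "[(1 + (3 - 2 * s))\<^sup>2 = 8 * (3 - 2 * s)] (mod int p)" "[1 - y = (3 - 2 * s)\<^sup>2] (mod int p)"
      using sp by (simp_all only: cong_iff_dvd_diff dvd_mult)
  qed
  from zcong_trans[OF F_zcong_form zcong_of_int[OF this]] obtain t where t: "t \<in> Zp" "F y = of_nat p * t"
    by (auto elim: zcongE)
  have "F x - F y = (of_int ((1 - x) ^ n - 1)) * F y + of_nat (p\<^sup>2) * z"
    unfolding z(2) by (simp only: of_int_diff of_int_1 left_diff_distrib mult_1_left diff_add_eq)
  also have "\<dots> = of_nat (p\<^sup>2) * (of_int q * t + z)"
    unfolding q t(2) by (simp add: power2_eq_square algebra_simps)
  finally have diff: "zcong (p\<^sup>2) (F x - F y) 0"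
    using z(1) t(1) by (intro zcongI[of "of_int q * t + z"] Zp_add Zp_mult) auto
  have "zcong (p\<^sup>2) (\<Sum>k\<le>n. of_nat (n choose k) * d k * of_int (4 ^ k * (6 * s * W k)))
      (\<Sum>k\<le>n. of_nat (n choose k) * d k * of_int (4 ^ k * ((4 + 3 * s) ^ k - (4 - 3 * s) ^ k)))"
    using p_eq s by (intro zcong_sum zcong_mult_left zcong_of_int cong_scalar_left W_binet_cong
        Zp_mult of_nat_in_Zp d_in_Zp) auto
  also have "(\<lambda>k. 4 ^ k * ((4 + 3 * s) ^ k - (4 - 3 * s) ^ k)) = (\<lambda>k. (- x) ^ k - (- y) ^ k)"
  proof
    fix k
    have xy: "- x = 4 * (4 + 3 * s)" "- y = 4 * (4 - 3 * s)" by (simp_all add: x_def y_def)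
    show "4 ^ k * ((4 + 3 * s) ^ k - (4 - 3 * s) ^ k) = (- x) ^ k - (- y) ^ k"
      unfolding xy power_mult_distrib by (simp only: right_diff_distrib)
  qed
  also have "(\<Sum>k\<le>n. of_nat (n choose k) * d k * of_int ((- x) ^ k - (- y) ^ k)) = F x - F y"
    by (simp only: of_int_diff right_diff_distrib sum_subtractf)
  also note diff
  finally have "zcong (p\<^sup>2) (of_int (6 * s) * (\<Sum>k\<le>n. of_nat (n choose k) * d k * of_int (4 ^ k * W k))) 0"
    by (simp add: sum_distrib_left mult_ac)
  then show ?thesis using cop_s by (rule zcong_cancel_int)
qed

end

section \<open>Deduction of the three congruences\<close>

theorem theorem3:
  fixes p :: nat
  assumes "prime p"
  shows "([p = 7] (mod 8) \<longrightarrow>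
           rat_cong_sq p
             (\<Sum>k = 0..p - 1. of_nat ((p - 1) choose k) * of_nat ((2 * k) choose k) ^ 2
                * (of_int (W k) / 4 ^ k))
             0)
       \<and> ([p = 1] (mod 6) \<longrightarrow>
           rat_cong_sq p
             (\<Sum>k = 0..p - 1. of_nat ((p - 1) choose k) * of_nat ((2 * k) choose k) ^ 2
                * ((- 1) ^ k * of_int (M k) / 16 ^ k))
             0)
       \<and> ([p = 7] (mod 12) \<longrightarrow>
           rat_cong_sq p
             (\<Sum>k | k \<in> {0..p - 1} \<and> [k = 0] (mod 3).
                of_nat ((p - 1) choose k) * of_nat ((2 * k) choose k) ^ 2 * (1 / 16 ^ k))
             (1 / 3 * (\<Sum>k = 0..p - 1.
                of_nat ((p - 1) choose k) * of_nat ((2 * k) choose k) ^ 2 * (1 / 16 ^ k))))"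
proof (cases "p = 2")
  case True
  \<comment> \<open>The prime 2 lies in none of the three residue classes.\<close>
  then show ?thesis by (simp add: cong_def)
next
  case False
  then have "odd p" using assms prime_odd_nat[of p] prime_ge_2_nat[of p] by auto
  then obtain n where n: "p = 2 * n + 1" by (rule oddE)
  interpret localization_at_odd_prime p n
    by unfold_locales (use assms n in auto)
  have zero: "0 \<in> Zp" using of_int_in_Zp[of 0] by simp
  show ?thesis
  proof (intro conjI impI)
    assume "[p = 7] (mod 8)"
    then have "p mod 8 = 7" by (simp add: cong_def)
    from sum_W_zcong_0[OF this]
    have "rat_cong_sq p (\<Sum>k = 0..p - 1. T k * of_int (4 ^ k * W k)) 0"
      by (intro rat_cong_sqI sum_T_in_Zp zero zcong_trans[OF sum_T_zcong])
    also have "(\<Sum>k = 0..p - 1. T k * of_int (4 ^ k * W k)) = (\<Sum>k = 0..p - 1.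
        of_nat ((p - 1) choose k) * of_nat ((2 * k) choose k) ^ 2 * (of_int (W k) / 4 ^ k))"
    proof (rule sum.cong[OF refl])
      fix k
      have "(16::rat) ^ k = 4 ^ k * 4 ^ k" by (simp flip: power_mult_distrib)
      then show "T k * of_int (4 ^ k * W k)
          = of_nat ((p - 1) choose k) * of_nat ((2 * k) choose k) ^ 2 * (of_int (W k) / 4 ^ k)"
        by (simp add: T_def)
    qed
    finally show "rat_cong_sq p (\<Sum>k = 0..p - 1.
        of_nat ((p - 1) choose k) * of_nat ((2 * k) choose k) ^ 2 * (of_int (W k) / 4 ^ k)) 0" .
  next
    assume "[p = 1] (mod 6)"
    then have "p mod 6 = 1" by (simp add: cong_def)
    then have "3 dvd n" using n by presburger
    from sum_T_zcong[of "\<lambda>k. (- 1) ^ k * M k", unfolded sum_M_eq_0[OF this]]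
    have "rat_cong_sq p (\<Sum>k = 0..p - 1. T k * of_int ((- 1) ^ k * M k)) 0"
      by (intro rat_cong_sqI sum_T_in_Zp zero)
    then show "rat_cong_sq p (\<Sum>k = 0..p - 1.
        of_nat ((p - 1) choose k) * of_nat ((2 * k) choose k) ^ 2 * ((- 1) ^ k * of_int (M k) / 16 ^ k)) 0"
      by (simp add: T_def)
  next
    assume "[p = 7] (mod 12)"
    then have p: "p mod 12 = 7" by (simp add: cong_def)
    then have n3: "odd n" "3 dvd n" using n by presburger+
    have "p > 3" using p mod_less_eq_dividend[of p 12] by linarith
    define S where "S c = (\<Sum>k = 0..p - 1. T k * of_int (c k))" for c :: "nat \<Rightarrow> int"
    have S_in_Zp: "S c \<in> Zp" for c unfolding S_def by (rule sum_T_in_Zp)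
    let ?a = "\<lambda>k. if 3 dvd k then 1 else 0 :: int"
    \<comment> \<open>Three times the difference of the two sides has weight 3 - 1 = 2 at multiples
      of 3 and -1 elsewhere; 3 is a unit because p > 3.\<close>
    have "of_int 3 * (S ?a - 1 / 3 * S (\<lambda>k. 1)) = 3 * S ?a - S (\<lambda>k. 1)"
      by simp
    also have "\<dots> = (\<Sum>k = 0..p - 1. 3 * (T k * of_int (?a k)) - T k * of_int 1)"
      by (simp only: S_def sum_distrib_left sum_subtractf)
    also have "\<dots> = S (\<lambda>k. if 3 dvd k then 2 else - 1)"
      unfolding S_def by (intro sum.cong) auto
    finally have "S (\<lambda>k. if 3 dvd k then 2 else - 1) = of_int 3 * (S ?a - 1 / 3 * S (\<lambda>k. 1))" ..
    with sum_T_zcong[of "\<lambda>k. if 3 dvd k then 2 else - 1", unfolded sum_mod_3_eq_0[OF n3]]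
    have "zcong (p\<^sup>2) (of_int 3 * (S ?a - 1 / 3 * S (\<lambda>k. 1))) 0"
      by (simp only: S_def)
    then have "zcong (p\<^sup>2) (S ?a - 1 / 3 * S (\<lambda>k. 1)) 0"
      by (rule zcong_cancel_int) (use coprime_p_if_less[of 3] \<open>p > 3\<close> in simp)
    then have "zcong (p\<^sup>2) (S ?a) (1 / 3 * S (\<lambda>k. 1))"
      unfolding zcong_def diff_0_right .
    moreover have "1 / 3 * S (\<lambda>k. 1) \<in> Zp"
      using inverse_nat_in_Zp[of 3] \<open>p > 3\<close> by (intro Zp_mult S_in_Zp) simp
    ultimately have "rat_cong_sq p (S ?a) (1 / 3 * S (\<lambda>k. 1))"
      using S_in_Zp by (intro rat_cong_sqI)
    moreover have "S ?a = (\<Sum>k | k \<in> {0..p - 1} \<and> [k = 0] (mod 3).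
        of_nat ((p - 1) choose k) * of_nat ((2 * k) choose k) ^ 2 * (1 / 16 ^ k))"
      unfolding S_def
      by (rule sum.mono_neutral_cong_right) (auto simp: T_def cong_0_iff split: if_splits)
    ultimately show "rat_cong_sq p
             (\<Sum>k | k \<in> {0..p - 1} \<and> [k = 0] (mod 3).
                of_nat ((p - 1) choose k) * of_nat ((2 * k) choose k) ^ 2 * (1 / 16 ^ k))
             (1 / 3 * (\<Sum>k = 0..p - 1.
                of_nat ((p - 1) choose k) * of_nat ((2 * k) choose k) ^ 2 * (1 / 16 ^ k)))"
      by (simp add: S_def T_def)
  qed
qed

end
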